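(* Let $\mathcal{H}$ be a hypergraph and assume that $\emptyset$ is not an edge of $\mathcal{H}$. Then $$\chi_{\ell}(\operatorname{KG}^p(\mathcal{H}))\geq\min\left(\left\lceil\frac{\operatorname{cd}^p(\mathcal{H})}{p}\right\rceil+1,\left\lceil\frac{\operatorname{cd}^p(\mathcal{H})}{p-1}\right\rceil\right)$$ for any prime number $p$.
   Context: A hypergraph is a pair $\mathcal{H}=(V(\mathcal{H}),E(\mathcal{H}))$, where $V(\mathcal{H})$ is a finite set (the vertex set) and $E(\mathcal{H})$ is a family of subsets of $V(\mathcal{H})$ (the edge set). It is $q$-uniform if every edge has cardinality $q$. A coloring of $\mathcal{H}$ is a map $c:V(\mathcal{H})\to[t]=\{1,\ldots,t\}$ for some positive integer $t$; it is proper if there is no monochromatic edge, i.e. no edge $e$ with $|c(e)|=1$. The chromatic number $\chi(\mathcal{H})$ is the minimal $t$ for which a proper coloring with colors in $[t]$ exists; thus "$\chi(\mathcal{H})\leq q$" means that a proper coloring with colors in $[q]$ exists. For $X\subseteq V(\mathcal{H})$, the induced subhypergraph $\mathcal{H}[X]$ has vertex set $X$ and edge set $\{e\in E(\mathcal{H}):e\subseteq X\}$. For an integer $q\geq 2$, the Kneser hypergraph $\operatorname{KG}^q(\mathcal{H})$ has vertex set $E(\mathcal{H})$, and its edges are the sets $\{e_1,\ldots,e_q\}$ with $e_1,\ldots,e_q\in E(\mathcal{H})$ and $e_i\cap e_j=\emptyset$ for all $i\neq j$. The $q$-colorability defect is $\operatorname{cd}^q(\mathcal{H})=\min\{|Y|:\,Y\subseteq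 V(\mathcal{H}),\ \chi(\mathcal{H}[V(\mathcal{H})\setminus Y])\leq q\}$. Local chromatic number of a uniform hypergraph $\mathcal{G}=(V,E)$: for $X\subseteq V$, let $\mathcal{N}(X)=\{v\in V:\,\exists e\in E\text{ such that }e\setminus X=\{v\}\}$ and $\mathcal{N}[X]=X\cup\mathcal{N}(X)$. Then $$\chi_{\ell}(\mathcal{G})=\min_{c}\max_{e\in E,\,v\in e}|c(\mathcal{N}[e\setminus\{v\}])|,$$ where the minimum is taken over all proper colorings $c$ of $\mathcal{G}$ (with any number of colors). *)

theory Defs
  imports Complex_Main "HOL-Library.Extended_Nat" "HOL-Library.FuncSet"
    "HOL-Computational_Algebra.Primes"
begin

type_synonym 'a hypergraph = "'a set \<times> 'a set set"

abbreviation verts :: "'a hypergraph \<Rightarrow> 'a set" where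
  "verts H \<equiv> fst H"

abbreviation edges :: "'a hypergraph \<Rightarrow> 'a set set" where
  "edges H \<equiv> snd H"

definition hypergraph :: "'a hypergraph \<Rightarrow> bool" where
  "hypergraph H \<longleftrightarrow> finite (verts H) \<and> edges H \<subseteq> Pow (verts H)"

definition coloring :: "'a hypergraph \<Rightarrow> nat \<Rightarrow> ('a \<Rightarrow> nat) \<Rightarrow> bool" where
  "coloring H t c \<longleftrightarrow> t > 0 \<and> c \<in> verts H \<rightarrow> {1..t}"

text \<open>An empty edge is not monochromatic, since it has zero colors; a singleton edge always is.\<close>

definition proper_coloring :: "'a hypergraph \<Rightarrow> nat \<Rightarrow> ('a \<Rightarrow> nat) \<Rightarrow> bool" where
  "proper_coloring H t c \<longleftrightarrow> coloring H t c \<and> \<not> (\<exists>e\<in>edges H. card (c ` e) = 1)"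

text \<open>A hypergraph with a singleton edge has no proper coloring; its chromatic number is \<open>\<infinity>\<close>.\<close>

definition chromatic_number :: "'a hypergraph \<Rightarrow> enat" where
  "chromatic_number H = Inf {enat t | t. \<exists>c. proper_coloring H t c}"

lemma chromatic_number_le_iff:
  assumes "q > 0"
  shows "chromatic_number H \<le> enat q \<longleftrightarrow> (\<exists>c. proper_coloring H q c)"
proof
  let ?A = "{enat t | t. \<exists>c. proper_coloring H t c}"
  assume le: "chromatic_number H \<le> enat q"
  then have "?A \<noteq> {}"
    unfolding chromatic_number_def by (metis Inf_empty enat_ord_code(5) top_enat_def infinity_ileE)
  then have "Inf ?A \<in> ?A"
    unfolding Inf_enat_def by (metis (mono_tags, lifting) LeastI ex_in_conv)
  then obtain t c where tc: "proper_coloring H t c" and "enat t = Inf ?A"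
    by auto
  with le have "t \<le> q"
    by (metis chromatic_number_def enat_ord_simps(1))
  with tc assms have "proper_coloring H q c"
    unfolding proper_coloring_def coloring_def by fastforce
  then show "\<exists>c. proper_coloring H q c" by blast
next
  assume "\<exists>c. proper_coloring H q c"
  then show "chromatic_number H \<le> enat q"
    unfolding chromatic_number_def by (intro Inf_lower) auto
qed

definition induced :: "'a hypergraph \<Rightarrow> 'a set \<Rightarrow> 'a hypergraph" where
  "induced H X = (X, {e \<in> edges H. e \<subseteq> X})"

definition kneser :: "nat \<Rightarrow> 'a hypergraph \<Rightarrow> 'a set hypergraph" where
  "kneser q H =
    (edges H,
     {f ` {1..q} | f. f \<in> {1..q} \<rightarrow> edges H \<and>
        (\<forall>i\<in>{1..q}. \<forall>j\<in>{1..q}. i \<noteq> j \<longrightarrow> f i \<inter> f j = {})})"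

definition colorability_defect :: "nat \<Rightarrow> 'a hypergraph \<Rightarrow> nat" where
  "colorability_defect q H =
    Min {card Y | Y. Y \<subseteq> verts H \<and> chromatic_number (induced H (verts H - Y)) \<le> enat q}"

definition nbhd :: "'a hypergraph \<Rightarrow> 'a set \<Rightarrow> 'a set" where
  "nbhd G X = {v \<in> verts G. \<exists>e\<in>edges G. e - X = {v}}"

definition closed_nbhd :: "'a hypergraph \<Rightarrow> 'a set \<Rightarrow> 'a set" where
  "closed_nbhd G X = X \<union> nbhd G X"

text \<open>
  In a hypergraph all of whose edges have at least two elements the maximum below ranges over
  positive integers. For an edgeless hypergraph it is a maximum over the empty set, which is given
  the value 1, the neutral element of max on the positive integers. This agrees with the usual
  convention that an edgeless graph has local chromatic number 1.
\<close>

definition max_local_colors :: "'a hypergraph \<Rightarrow> ('a \<Rightarrow> nat) \<Rightarrow> nat" where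
  "max_local_colors G c =
    (if edges G = {} then 1
     else Max {card (c ` closed_nbhd G (e - {v})) | e v. e \<in> edges G \<and> v \<in> e})"

definition local_chromatic_number :: "'a hypergraph \<Rightarrow> nat" where
  "local_chromatic_number G =
    Inf {max_local_colors G c | c. \<exists>t. proper_coloring G t c}"

end

theory Submission
  imports Defs "HOL-Number_Theory.Cong"
begin

text \<open>
  Let \<open>d\<close> be the colorability defect, \<open>n\<close> the number of vertices of \<open>H\<close>, and \<open>c\<close> a proper coloring of
  \<open>KG\<^sup>p(H)\<close>. The vertices are numbered, and a vector in \<open>(\<int>\<^sub>p \<union> {0})\<^sup>n\<close> is read as \<open>p\<close> disjoint parts of
  the vertex set, one for each sign. The crucial claim is that the parts of some vector contain
  edges of so many colors that, with \<open>K\<^sub>e\<close> the set of colors of the edges inside part \<open>e\<close>, a family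
  of subsets of the \<open>K\<^sub>e\<close> whose sizes differ pairwise by at most one can have \<open>d\<close> elements in total
  (\<open>ex_balanced\<close>).

  The claim gives the bound if \<open>d \<ge> p\<close>. All \<open>K\<^sub>e\<close> are then nonempty, so choosing an edge of \<open>H\<close> in each
  part yields an edge of \<open>KG\<^sup>p(H)\<close>. Let \<open>K\<^sub>a\<close> be the largest of the sets and \<open>k\<close> its size. Dropping the
  vertex chosen in part \<open>a\<close> leaves a set whose closed neighborhood contains every edge inside part
  \<open>a\<close>, so it sees the \<open>k\<close> colors of \<open>K\<^sub>a\<close>. If some \<open>K\<^sub>e\<close> has a further color, it can be made visible too
  and \<open>k + 1\<close> colors are seen, where \<open>d \<le> p k\<close>. Otherwise all the \<open>K\<^sub>e\<close> lie in \<open>K\<^sub>a\<close>, and as no color is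
  in all \<open>p\<close> of them, \<open>d \<le> (p - 1) k\<close> (\<open>max_local_colors_lower_bound\<close>).

  The claim is topological: it rests on Dold's theorem for the join of \<open>n\<close> copies of \<open>\<int>\<^sub>p\<close>. If it
  failed, each nonzero vector \<open>X\<close> would get a level below \<open>n - 1\<close> and a sign. Vectors whose parts
  contain no edges have at most \<open>n - d\<close> nonzero entries by the definition of \<open>d\<close>, and they take the
  levels below \<open>n - d\<close> according to their size; the others lie above, ordered by the size of the
  balanced subfamily. Levels grow with \<open>X\<close>, vectors that are comparable and have the same level have
  the same sign, and rotating all signs of \<open>X\<close> rotates its label. Such a labelling is an equivariant
  simplicial map from the barycentric subdivision of the join of \<open>n\<close> copies of \<open>\<int>\<^sub>p\<close> to the join of
  \<open>n - 1\<close> copies, and there is none (\<open>no_equivariant_sign_sets\<close>).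

  The nonexistence is a Lefschetz argument carried out with explicit sums. A labelling with values in
  the join of \<open>m < n\<close> copies induces a chain map. On the join of the first \<open>m\<close> copies it is a self-map
  that is null-homotopic, because the cone with apex in the next copy is available in the source. So
  its alternating trace on augmented chains is \<open>0\<close> (\<open>trace_eq_0\<close>). On the other hand, the trace is
  \<open>1\<close> modulo \<open>p\<close>: the empty simplex contributes \<open>1\<close> and the other simplices come in orbits of size
  \<open>p\<close> with equal contributions (\<open>sum_faces_mod\<close>).
\<close>

section \<open>Oriented faces of a join of discrete sets\<close>

text \<open>
  The pair \<open>(i, e)\<close> is the point \<open>e\<close> of the \<open>i\<close>-th copy of \<open>{0..<p}\<close>. A face has at most one point in
  each copy, so it is a vector of length \<open>n\<close> with entries in \<open>{0..<p}\<close> or blank.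
\<close>

definition faces :: "nat \<Rightarrow> nat \<Rightarrow> (nat \<times> nat) set set" where
  "faces n p = {X. X \<subseteq> {..<n} \<times> {..<p} \<and> inj_on fst X}"

text \<open>
  The incidence number of \<open>X - {x}\<close> in the boundary of \<open>X\<close>, when faces are oriented by increasing first
  coordinate.
\<close>

definition osign :: "(nat \<times> nat) set \<Rightarrow> nat \<times> nat \<Rightarrow> int" where
  "osign X x = (-1) ^ card {y \<in> X. fst y < fst x}"

definition top_vertex :: "nat \<times> nat \<Rightarrow> (nat \<times> nat) set \<Rightarrow> bool" where
  "top_vertex t Y \<longleftrightarrow> t \<in> Y \<and> (\<forall>y\<in>Y. y \<noteq> t \<longrightarrow> fst y < fst t)"

lemma finite_face: "X \<in> faces n p \<Longrightarrow> finite X"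
  unfolding faces_def by (auto intro: finite_subset[of _ "{..<n} \<times> {..<p}"])

lemma finite_faces: "finite (faces n p)"
  unfolding faces_def by (rule finite_subset[of _ "Pow ({..<n} \<times> {..<p})"]) auto

lemma faces_subset: "X \<in> faces n p \<Longrightarrow> Y \<subseteq> X \<Longrightarrow> Y \<in> faces n p"
  unfolding faces_def by (auto intro: inj_on_subset)

lemma faces_mono: "m \<le> n \<Longrightarrow> faces m p \<subseteq> faces n p"
  unfolding faces_def by fastforce

lemma insert_top_in_faces:
  assumes "X \<in> faces m p" "0 < p" "m < n"
  shows "insert (m, 0) X \<in> faces n p"
  using assms unfolding faces_def by (force simp: inj_on_def)

lemma osign_top: "top_vertex t Y \<Longrightarrow> osign Y t = (-1) ^ card (Y - {t})"
proof -
  assume "top_vertex t Y"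
  then have "{y \<in> Y. fst y < fst t} = Y - {t}"
    unfolding top_vertex_def by auto
  then show ?thesis unfolding osign_def by simp
qed

lemma osign_cong: "fst x < fst v \<or> x = v \<Longrightarrow> osign (insert v X) x = osign (X - {v}) x"
  unfolding osign_def by (rule arg_cong[of _ _ "\<lambda>A. (-1) ^ card A"]) auto

lemma osign_swap_less:
  assumes "finite X" "x \<in> X" "x' \<in> X" "fst x' < fst x"
  shows "osign X x * osign (X - {x}) x' = - (osign X x' * osign (X - {x'}) x)"
proof -
  have 1: "{y \<in> X - {x}. fst y < fst x'} = {y \<in> X. fst y < fst x'}"
    using assms by auto
  have 2: "{y \<in> X. fst y < fst x} = insert x' {y \<in> X - {x'}. fst y < fst x}"
    using assms by auto
  have "osign X x = - osign (X - {x'}) x"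
    using assms(1) unfolding osign_def 2 by (subst card_insert_disjoint) auto
  moreover have "osign (X - {x}) x' = osign X x'"
    unfolding osign_def 1 ..
  ultimately show ?thesis by simp
qed

lemma osign_swap:
  assumes "X \<in> faces n p" "x \<in> X" "x' \<in> X" "x \<noteq> x'"
  shows "osign X x * osign (X - {x}) x' = - (osign X x' * osign (X - {x'}) x)"
proof -
  have "fst x \<noteq> fst x'"
    using assms unfolding faces_def inj_on_def by auto
  then consider "fst x' < fst x" | "fst x < fst x'" by linarith
  then show ?thesis
    using osign_swap_less[of X x x'] osign_swap_less[of X x' x] assms finite_face by cases auto
qed

text \<open>
  The boundary of a boundary vanishes because removing two vertices in the two possible orders
  gives opposite signs. The function \<open>g\<close> stands for any coefficients on the remaining faces.
\<close>

lemma boundary_boundary: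
  assumes X: "X \<in> faces n p"
  shows "(\<Sum>x\<in>X. osign X x * (\<Sum>x'\<in>X - {x}. osign (X - {x}) x' * g (X - {x} - {x'}))) = 0"
proof -
  have fin: "finite X" using X finite_face by blast
  define T where "T x x' = (if x' = x then 0 else osign X x * osign (X - {x}) x' * g (X - {x} - {x'}))"
    for x x' :: "nat \<times> nat"
  have anti: "T x x' = - T x' x" if "x \<in> X" "x' \<in> X" for x x'
  proof (cases "x = x'")
    case False
    have "X - {x} - {x'} = X - {x'} - {x}" by auto
    then show ?thesis
      using osign_swap[OF X that False] False unfolding T_def by simp
  qed (simp add: T_def)
  have "(\<Sum>x\<in>X. osign X x * (\<Sum>x'\<in>X - {x}. osign (X - {x}) x' * g (X - {x} - {x'})))
      = (\<Sum>x\<in>X. \<Sum>x'\<in>X. T x x')"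
  proof (rule sum.cong[OF refl])
    fix x assume "x \<in> X"
    have "(\<Sum>x'\<in>X. T x x') = (\<Sum>x'\<in>X - {x}. T x x')"
      using fin by (intro sum.mono_neutral_right) (auto simp: T_def)
    then show "osign X x * (\<Sum>x'\<in>X - {x}. osign (X - {x}) x' * g (X - {x} - {x'})) = (\<Sum>x'\<in>X. T x x')"
      by (simp add: T_def sum_distrib_left mult.assoc)
  qed
  moreover have "(\<Sum>x\<in>X. \<Sum>x'\<in>X. T x x') = - (\<Sum>x\<in>X. \<Sum>x'\<in>X. T x x')"
  proof -
    have "(\<Sum>x\<in>X. \<Sum>x'\<in>X. T x x') = (\<Sum>x\<in>X. \<Sum>x'\<in>X. - T x' x)"
      by (intro sum.cong refl anti)
    also have "\<dots> = - (\<Sum>x\<in>X. \<Sum>x'\<in>X. T x' x)"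
      by (simp add: sum_negf)
    also have "(\<Sum>x\<in>X. \<Sum>x'\<in>X. T x' x) = (\<Sum>x\<in>X. \<Sum>x'\<in>X. T x x')"
      by (rule sum.swap)
    finally show ?thesis .
  qed
  ultimately show ?thesis by linarith
qed

section \<open>The chain map of a monotone labelling\<close>

text \<open>
  A labelling \<open>lab\<close> of the nonempty faces is a vertex map on the barycentric subdivision. Composing
  the subdivision operator with the induced simplicial map sends \<open>X\<close> to the cone with apex \<open>lab X\<close> over
  the image of the boundary of \<open>X\<close>. For \<open>X\<close> with \<open>k\<close> elements, \<open>subdiv_coef lab k X Y\<close> is the coefficient
  of \<open>Y\<close> in that chain. As labels move up along a flag, the apex is always the last vertex, so that
  the sign of the cone depends only on the size of \<open>Y\<close>; cones over faces that already contain the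
  apex are degenerate and contribute \<open>0\<close>. The empty face is included, with image itself, which makes
  the chains augmented.
\<close>

primrec subdiv_coef :: "((nat \<times> nat) set \<Rightarrow> nat \<times> nat) \<Rightarrow> nat \<Rightarrow> (nat \<times> nat) set \<Rightarrow> (nat \<times> nat) set \<Rightarrow> int"
  where
  "subdiv_coef lab 0 X Y = (if Y = {} then 1 else 0)"
| "subdiv_coef lab (Suc k) X Y =
    (if top_vertex (lab X) Y
     then (-1) ^ card (Y - {lab X}) *
       (\<Sum>x\<in>X. osign X x * subdiv_coef lab k (X - {x}) (Y - {lab X}))
     else 0)"

lemma subdiv_coef_inj:
  "subdiv_coef lab k X Y \<noteq> 0 \<Longrightarrow> inj_on fst Y"
proof (induction k arbitrary: X Y)
  case 0
  then show ?case by (auto split: if_splits)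
next
  case (Suc k)
  let ?t = "lab X"
  have top: "top_vertex ?t Y" using Suc.prems by (auto split: if_splits)
  obtain x where "subdiv_coef lab k (X - {x}) (Y - {?t}) \<noteq> 0"
    using Suc.prems by (auto split: if_splits elim!: sum.not_neutral_contains_not_neutral)
  then have "inj_on fst (Y - {?t})" by (rule Suc.IH)
  with top show ?case
    unfolding top_vertex_def inj_on_def by (metis DiffI empty_iff insert_iff less_irrefl)
qed

locale monotone_labelling =
  fixes n m p :: nat and lab :: "(nat \<times> nat) set \<Rightarrow> nat \<times> nat"
  assumes lab_in: "X \<in> faces n p \<Longrightarrow> X \<noteq> {} \<Longrightarrow> lab X \<in> {..<m} \<times> {..<p}"
    and lab_mono: "Y \<in> faces n p \<Longrightarrow> X \<noteq> {} \<Longrightarrow> X \<subseteq> Y \<Longrightarrow> fst (lab X) < fst (lab Y) \<or> lab X = lab Y"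
begin

abbreviation "coef \<equiv> subdiv_coef lab"

lemma coef_support:
  assumes X: "X \<in> faces n p" and Z: "Z \<subseteq> X" "card Z = k" and nz: "coef k Z Y \<noteq> 0" and y: "y \<in> Y"
  shows "fst y < fst (lab X) \<or> y = lab X"
proof (cases k)
  case 0
  then show ?thesis using nz y by (auto split: if_splits)
next
  case (Suc l)
  then have "top_vertex (lab Z) Y" using nz by (auto split: if_splits)
  then have "fst y < fst (lab Z) \<or> y = lab Z"
    using y unfolding top_vertex_def by auto
  moreover have "Z \<noteq> {}" using Z(2) Suc by auto
  ultimately show ?thesis
    using lab_mono[OF X _ Z(1)] by (metis less_trans)
qed

text \<open>
  The map commutes with the boundary: on the left is the coefficient of \<open>Y\<close> in the image of the
  boundary of \<open>X\<close>, on the right its coefficient in the boundary of the image of \<open>X\<close>. The sum on the right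
  may run over all vertices outside \<open>Y\<close>, since coefficients vanish on sets that are not faces. If \<open>Y\<close>
  lies below the label \<open>t\<close> of \<open>X\<close>, only the base of the cone contributes. If \<open>Y\<close> has \<open>t\<close> on top, the
  sides of the cone contribute, and they are evaluated by induction on \<open>Y - {t}\<close> and
  \<open>boundary_boundary\<close>. If \<open>Y\<close> has any other vertex at or above \<open>t\<close>, both sides vanish.
\<close>

lemma coef_chain_map:
  assumes "X \<in> faces n p" "card X = Suc k" "finite Y"
  shows "(\<Sum>x\<in>X. osign X x * coef k (X - {x}) Y)
    = (\<Sum>y\<in>{..<m} \<times> {..<p} - Y. osign (insert y Y) y * coef (Suc k) X (insert y Y))"
  using assms
proof (induction k arbitrary: X Y rule: less_induct)
  case (less k)
  let ?V = "{..<m} \<times> {..<p}" and ?t = "lab X"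
  let ?D = "\<lambda>Y. \<Sum>x\<in>X. osign X x * coef k (X - {x}) Y"
  have X: "X \<in> faces n p" and finX: "finite X" and Xne: "X \<noteq> {}"
    using less.prems finite_face by auto
  have tV: "?t \<in> ?V" using lab_in[OF X Xne] .
  have cardx: "card (X - {x}) = k" if "x \<in> X" for x
    using less.prems finX that by simp
  consider (low) "\<forall>y\<in>Y. fst y < fst ?t" | (top) "top_vertex ?t Y"
    | (high) y where "y \<in> Y" "\<not> fst y < fst ?t" "y \<noteq> ?t"
    unfolding top_vertex_def by blast
  then show ?case
  proof cases
    case low
    then have tY: "?t \<notin> Y" by auto
    have 1: "top_vertex ?t (insert ?t Y)" using low unfolding top_vertex_def by auto
    have "coef (Suc k) X (insert y Y) = 0" if "y \<in> ?V - Y" "y \<noteq> ?t" for y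
      using that tY by (simp add: top_vertex_def)
    then have "(\<Sum>y\<in>?V - Y. osign (insert y Y) y * coef (Suc k) X (insert y Y))
        = (\<Sum>y\<in>{?t}. osign (insert y Y) y * coef (Suc k) X (insert y Y))"
      using tV tY by (intro sum.mono_neutral_right) auto
    also have "\<dots> = (-1) ^ card Y * ((-1) ^ card Y * ?D Y)"
      using tY 1 by (simp add: osign_top[OF 1])
    also have "\<dots> = ?D Y"
      by (simp flip: power_add mult_2 mult.assoc)
    finally show ?thesis by simp
  next
    case top
    let ?Y = "Y - {?t}"
    have Y: "insert ?t ?Y = Y" "?t \<in> Y" using top unfolding top_vertex_def by auto
    let ?L = "{y \<in> ?V - Y. fst y < fst ?t}"
    \<comment> \<open>Facets of the cone that contain the apex are cones over facets of its base.\<close>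
    have tm: "osign (insert y Y) y * coef (Suc k) X (insert y Y)
        = (-1) ^ card Y * (osign (insert y ?Y) y * ?D (insert y ?Y))" if "y \<in> ?L" for y
    proof -
      have ne: "y \<noteq> ?t" "y \<notin> Y" using that by auto
      have t: "top_vertex ?t (insert y Y)" using top that unfolding top_vertex_def by auto
      have e: "insert y Y - {?t} = insert y ?Y" using ne by auto
      have "card (insert y ?Y) = card Y"
        using ne Y(2) less.prems(3) card.remove[of Y ?t] by simp
      moreover have "osign (insert y Y) y = osign (insert y ?Y) y"
        using osign_cong[of y ?t "insert y Y"] that Y(2) e by (simp add: insert_absorb)
      ultimately show ?thesis using t e by simp
    qed
    have "(\<Sum>y\<in>?V - Y. osign (insert y Y) y * coef (Suc k) X (insert y Y))
        = (\<Sum>y\<in>?L. osign (insert y Y) y * coef (Suc k) X (insert y Y))"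
      by (rule sum.mono_neutral_right) (use Y in \<open>auto simp: top_vertex_def\<close>)
    also have "\<dots> = (\<Sum>y\<in>?L. (-1) ^ card Y * (osign (insert y ?Y) y * ?D (insert y ?Y)))"
      by (rule sum.cong[OF refl tm])
    also have "\<dots> = (-1) ^ card Y * (\<Sum>x\<in>X. osign X x *
        (\<Sum>y\<in>?L. osign (insert y ?Y) y * coef k (X - {x}) (insert y ?Y)))"
      unfolding sum_distrib_left by (subst sum.swap) (simp add: mult_ac)
    also have "\<dots> = (-1) ^ card Y * (\<Sum>x\<in>X. osign X x *
        ((if k = 0 then 0 else \<Sum>x'\<in>X - {x}. osign (X - {x}) x' * coef (k - 1) (X - {x} - {x'}) ?Y)
          - (-1) ^ card ?Y * coef k (X - {x}) Y))"
    proof -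
      have "(\<Sum>y\<in>?L. osign (insert y ?Y) y * coef k (X - {x}) (insert y ?Y))
          = (if k = 0 then 0 else \<Sum>x'\<in>X - {x}. osign (X - {x}) x' * coef (k - 1) (X - {x} - {x'}) ?Y)
            - (-1) ^ card ?Y * coef k (X - {x}) Y" if x: "x \<in> X" for x
      proof -
        let ?f = "\<lambda>y. osign (insert y ?Y) y * coef k (X - {x}) (insert y ?Y)"
        \<comment> \<open>The induction hypothesis sums over all \<open>y\<close>; besides those below \<open>t\<close> only \<open>y = t\<close> remains.\<close>
        have z: "?f y = 0" if "y \<in> ?V - ?Y - insert ?t ?L" for y
        proof -
          have "\<not> fst y < fst ?t" "y \<noteq> ?t" using that Y by auto
          then show ?thesis
            using coef_support[OF X _ cardx[OF x], of "insert y ?Y" y] by auto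
        qed
        have "sum ?f (?V - ?Y) = sum ?f (insert ?t ?L)"
          using z tV Y by (intro sum.mono_neutral_right) auto
        also have "\<dots> = ?f ?t + sum ?f ?L"
          by (rule sum.insert) auto
        also have "?f ?t = (-1) ^ card ?Y * coef k (X - {x}) Y"
          using Y osign_top[OF top] by simp
        finally have 1: "sum ?f ?L = sum ?f (?V - ?Y) - (-1) ^ card ?Y * coef k (X - {x}) Y"
          by simp
        show ?thesis
        proof (cases k)
          case 0
          have "sum ?f ?L = 0" using 0 by (intro sum.neutral) auto
          moreover have "coef k (X - {x}) Y = 0" using 0 Y by auto
          ultimately show ?thesis using 0 by simp
        next
          case (Suc l)
          have "sum ?f (?V - ?Y) = (\<Sum>x'\<in>X - {x}. osign (X - {x}) x' * coef l (X - {x} - {x'}) ?Y)"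
            using less.IH[of l "X - {x}" ?Y] Suc cardx[OF x] faces_subset[OF X, of "X - {x}"] less.prems(3)
            by simp
          with 1 Suc show ?thesis by simp
        qed
      qed
      then show ?thesis by (intro arg_cong2[of _ _ _ _ "(*)"] sum.cong refl) auto
    qed
    also have "\<dots> = (-1) ^ card Y * (- ((-1) ^ card ?Y * ?D Y))"
    proof -
      have "(\<Sum>x\<in>X. osign X x * (if k = 0 then 0
          else \<Sum>x'\<in>X - {x}. osign (X - {x}) x' * coef (k - 1) (X - {x} - {x'}) ?Y)) = 0"
        using boundary_boundary[OF X, of "\<lambda>Z. coef (k - 1) Z ?Y"] by (cases "k = 0") auto
      then show ?thesis
        by (simp add: right_diff_distrib sum_subtractf sum_distrib_left mult_ac)
    qed
    also have "card Y = Suc (card ?Y)" using Y less.prems(3) by (metis card.remove)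
    also have "(-1) ^ Suc (card ?Y) * (- ((-1) ^ card ?Y * ?D Y)) = ?D Y"
      by (simp flip: power_add mult_2 mult.assoc)
    finally show ?thesis by simp
  next
    case high
    have "coef k (X - {x}) Y = 0" if "x \<in> X" for x
      using coef_support[OF X _ cardx[OF that] _ high(1)] high by auto
    moreover have "coef (Suc k) X (insert y' Y) = 0" for y'
      using high by (auto simp: top_vertex_def)
    ultimately show ?thesis by (simp add: sum.neutral)
  qed
qed

text \<open>
  Restricted to the first \<open>m\<close> copies, the chain map \<open>\<phi>\<close> is a self-map. Coning with the apex \<open>v = (m, 0)\<close> in
  the next copy gives a homotopy \<open>h X = \<phi> (X \<union> {v})\<close> with \<open>\<plusminus> \<phi> = \<partial> h - h \<partial>\<close>. The two sums on the right are
  traces of products of the same two matrices in opposite orders, hence equal.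
\<close>

lemma trace_eq_0:
  assumes "m < n" "0 < p"
  shows "(\<Sum>X\<in>faces m p. (-1) ^ card X * coef (card X) X X) = 0"
proof -
  let ?V = "{..<m} \<times> {..<p}" and ?v = "(m, 0) :: nat \<times> nat"
  let ?b = "\<lambda>X Y. coef (Suc (card X)) (insert ?v X) Y"
  have eq: "(-1) ^ card X * coef (card X) X X
      = (\<Sum>y\<in>?V - X. osign (insert y X) y * ?b X (insert y X))
        - (\<Sum>x\<in>X. osign X x * ?b (X - {x}) X)" if X: "X \<in> faces m p" for X
  proof -
    have fin: "finite X" using X finite_face by blast
    have vX: "?v \<notin> X" using X unfolding faces_def by auto
    have X': "insert ?v X \<in> faces n p"
      using insert_top_in_faces[OF X assms(2,1)] .
    have top: "top_vertex ?v (insert ?v X)"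
      using X unfolding faces_def top_vertex_def by auto
    have s: "osign (insert ?v X) x * coef (card X) (insert ?v X - {x}) X = osign X x * ?b (X - {x}) X"
      if x: "x \<in> X" for x
    proof -
      have "fst x < m" "x \<noteq> ?v" using X x unfolding faces_def by auto
      then have "osign (insert ?v X) x = osign X x" "insert ?v X - {x} = insert ?v (X - {x})"
        using osign_cong[of x ?v X] vX by auto
      moreover have "card X = Suc (card (X - {x}))" using x fin by (metis card.remove)
      ultimately show ?thesis by simp
    qed
    have "(\<Sum>x\<in>insert ?v X. osign (insert ?v X) x * coef (card X) (insert ?v X - {x}) X)
        = (-1) ^ card X * coef (card X) X X + (\<Sum>x\<in>X. osign X x * ?b (X - {x}) X)"
      using fin vX osign_top[OF top] s by simp
    moreover have "\<dots> = (\<Sum>y\<in>?V - X. osign (insert y X) y * ?b X (insert y X))"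
      using coef_chain_map[OF X' _ fin] fin vX calculation by simp
    ultimately show ?thesis by simp
  qed
  have finF: "finite (faces m p)" by (rule finite_faces)
  \<comment> \<open>Both double sums run over the pairs of a face and one of its facets.\<close>
  have "(\<Sum>X\<in>faces m p. \<Sum>y\<in>?V - X. osign (insert y X) y * ?b X (insert y X))
      = (\<Sum>(X, y)\<in>Sigma (faces m p) (\<lambda>X. ?V - X). osign (insert y X) y * ?b X (insert y X))"
    using finF by (simp add: sum.Sigma)
  also have "\<dots> = (\<Sum>(X, y)\<in>{(X, y). X \<in> faces m p \<and> y \<in> ?V - X \<and> insert y X \<in> faces m p}.
      osign (insert y X) y * ?b X (insert y X))"
  proof (rule sum.mono_neutral_right)
    show "finite (Sigma (faces m p) (\<lambda>X. ?V - X))" using finF by auto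
    show "{(X, y). X \<in> faces m p \<and> y \<in> ?V - X \<and> insert y X \<in> faces m p}
        \<subseteq> Sigma (faces m p) (\<lambda>X. ?V - X)" by auto
    show "\<forall>i\<in>Sigma (faces m p) (\<lambda>X. ?V - X)
        - {(X, y). X \<in> faces m p \<and> y \<in> ?V - X \<and> insert y X \<in> faces m p}.
        (case i of (X, y) \<Rightarrow> osign (insert y X) y * ?b X (insert y X)) = 0"
    proof
      fix i
      assume "i \<in> Sigma (faces m p) (\<lambda>X. ?V - X)
        - {(X, y). X \<in> faces m p \<and> y \<in> ?V - X \<and> insert y X \<in> faces m p}"
      then obtain X y where i: "i = (X, y)" "X \<in> faces m p" "y \<in> ?V" "insert y X \<notin> faces m p"
        by blast
      then have "\<not> inj_on fst (insert y X)" unfolding faces_def by blast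
      then have "?b X (insert y X) = 0"
        using subdiv_coef_inj[of lab "Suc (card X)" "insert ?v X" "insert y X"] by blast
      then show "(case i of (X, y) \<Rightarrow> osign (insert y X) y * ?b X (insert y X)) = 0"
        unfolding i(1) by (simp del: subdiv_coef.simps)
    qed
  qed
  also have "\<dots> = (\<Sum>(X, x)\<in>Sigma (faces m p) (\<lambda>X. X). osign X x * ?b (X - {x}) X)"
  proof (rule sum.reindex_bij_witness[where i = "\<lambda>(Z, z). (Z - {z}, z)" and j = "\<lambda>(X, y). (insert y X, y)"])
    fix q assume "q \<in> {(X, y). X \<in> faces m p \<and> y \<in> ?V - X \<and> insert y X \<in> faces m p}"
    then obtain X y where q: "q = (X, y)" "y \<notin> X" "insert y X \<in> faces m p" by blast
    then have "insert y X - {y} = X" by simp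
    with q show "(case case q of (X, y) \<Rightarrow> (insert y X, y) of (Z, z) \<Rightarrow> (Z - {z}, z)) = q"
      and "(case q of (X, y) \<Rightarrow> (insert y X, y)) \<in> Sigma (faces m p) (\<lambda>X. X)"
      and "(case case q of (X, y) \<Rightarrow> (insert y X, y) of (X, x) \<Rightarrow> osign X x * ?b (X - {x}) X)
        = (case q of (X, y) \<Rightarrow> osign (insert y X) y * ?b X (insert y X))"
      by (simp_all del: subdiv_coef.simps)
  next
    fix q assume "q \<in> Sigma (faces m p) (\<lambda>X. X)"
    then obtain Z z where q: "q = (Z, z)" "Z \<in> faces m p" "z \<in> Z" by auto
    then have "Z - {z} \<in> faces m p" "z \<in> ?V" "insert z (Z - {z}) = Z"
      using faces_subset[of Z m p "Z - {z}"] by (auto simp: faces_def)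
    with q show "(case q of (Z, z) \<Rightarrow> (Z - {z}, z))
        \<in> {(X, y). X \<in> faces m p \<and> y \<in> ?V - X \<and> insert y X \<in> faces m p}"
      and "(case case q of (Z, z) \<Rightarrow> (Z - {z}, z) of (X, y) \<Rightarrow> (insert y X, y)) = q"
      by simp_all
  qed
  also have "\<dots> = (\<Sum>X\<in>faces m p. \<Sum>x\<in>X. osign X x * ?b (X - {x}) X)"
    using finF finite_face by (subst sum.Sigma) auto
  finally show ?thesis
    by (simp add: eq sum_subtractf del: subdiv_coef.simps)
qed

end

section \<open>Rotation of the signs\<close>

definition rot :: "nat \<Rightarrow> nat \<times> nat \<Rightarrow> nat \<times> nat" where
  "rot p x = (fst x, (snd x + 1) mod p)"

definition first_vertex :: "(nat \<times> nat) set \<Rightarrow> nat \<times> nat" where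
  "first_vertex X = arg_min_on fst X"

lemma fst_rot [simp]: "fst (rot p x) = fst x"
  by (simp add: rot_def)

lemma snd_rot [simp]: "snd (rot p x) = (snd x + 1) mod p"
  by (simp add: rot_def)

lemma inj_on_rotate: "inj_on (\<lambda>e. (e + 1) mod p) {..<p :: nat}"
proof (rule inj_onI)
  fix a b assume "a \<in> {..<p}" "b \<in> {..<p}" "(a + 1) mod p = (b + 1) mod p"
  then show "a = b" by (auto simp: mod_Suc split: if_splits)
qed

lemma inj_on_rot: "inj_on (rot p) ({..<m} \<times> {..<p})"
proof (rule inj_onI)
  fix x y :: "nat \<times> nat"
  assume "x \<in> {..<m} \<times> {..<p}" "y \<in> {..<m} \<times> {..<p}" "rot p x = rot p y"
  then show "x = y"
    using inj_onD[OF inj_on_rotate[of p], of "snd x" "snd y"]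
    by (intro prod_eqI) (simp_all add: rot_def mem_Times_iff)
qed

lemma rot_image_subset: "X \<subseteq> {..<m} \<times> {..<p} \<Longrightarrow> rot p ` X \<subseteq> {..<m} \<times> {..<p}"
  unfolding rot_def by (auto intro!: mod_less_divisor dest!: subsetD)

lemma rot_face: "X \<in> faces m p \<Longrightarrow> rot p ` X \<in> faces m p"
  unfolding faces_def using rot_image_subset[of X m p] by (auto simp: inj_on_def)

lemma rot_faces: "image (rot p) ` faces m p = faces m p"
proof (rule endo_inj_surj[OF finite_faces])
  show "image (rot p) ` faces m p \<subseteq> faces m p" using rot_face by blast
  show "inj_on (image (rot p)) (faces m p)"
    by (rule inj_on_subset[OF inj_on_image_Pow[OF inj_on_rot]]) (auto simp: faces_def)
qed

lemma first_vertex: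
  assumes "X \<in> faces n p" "X \<noteq> {}"
  shows "first_vertex X \<in> X" "y \<in> X \<Longrightarrow> fst (first_vertex X) \<le> fst y"
  using arg_min_if_finite[OF finite_face[OF assms(1)] assms(2), of fst]
  unfolding first_vertex_def by (auto simp: not_less)

lemma first_vertex_rot:
  assumes X: "X \<in> faces n p" "X \<noteq> {}"
  shows "first_vertex (rot p ` X) = rot p (first_vertex X)"
proof -
  have X': "rot p ` X \<in> faces n p" "rot p ` X \<noteq> {}" using rot_face X by auto
  obtain x where x: "x \<in> X" "first_vertex (rot p ` X) = rot p x"
    using first_vertex(1)[OF X'] by auto
  have "fst x \<le> fst (first_vertex X)"
    using first_vertex(2)[OF X', of "rot p (first_vertex X)"] first_vertex(1)[OF X] x by auto
  moreover have "fst (first_vertex X) \<le> fst x"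
    by (rule first_vertex(2)[OF X x(1)])
  ultimately have "x = first_vertex X"
    using X(1) x(1) first_vertex(1)[OF X] unfolding faces_def inj_on_def by auto
  with x show ?thesis by simp
qed

lemma osign_rot:
  assumes "X \<subseteq> {..<m} \<times> {..<p}"
  shows "osign (rot p ` X) (rot p x) = osign X x"
proof -
  have "{y \<in> rot p ` X. fst y < fst (rot p x)} = rot p ` {y \<in> X. fst y < fst x}" by auto
  moreover have "inj_on (rot p) {y \<in> X. fst y < fst x}"
    using assms by (intro inj_on_subset[OF inj_on_rot[of p m]]) auto
  ultimately show ?thesis unfolding osign_def by (simp add: card_image)
qed

lemma top_vertex_rot:
  assumes "Y \<subseteq> {..<m} \<times> {..<p}" "t \<in> {..<m} \<times> {..<p}"
  shows "top_vertex (rot p t) (rot p ` Y) \<longleftrightarrow> top_vertex t Y"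
proof -
  have eq: "rot p y = rot p t \<longleftrightarrow> y = t" if "y \<in> Y" for y
    using inj_on_rot[of p m] assms that by (auto simp: inj_on_def)
  then have "rot p t \<in> rot p ` Y \<longleftrightarrow> t \<in> Y" by (auto simp: image_iff) metis+
  with eq show ?thesis unfolding top_vertex_def by auto
qed

text \<open>
  The sign at the first vertex divides the nonempty faces into \<open>p\<close> classes, which the rotation
  permutes cyclically. So every class has the same sum.
\<close>

lemma sum_faces_mod:
  fixes F :: "(nat \<times> nat) set \<Rightarrow> int"
  assumes inv: "\<And>X. X \<in> faces m p \<Longrightarrow> F (rot p ` X) = F X"
  shows "int p dvd (\<Sum>X\<in>faces m p - {{}}. F X)"
proof -
  define A where "A e = {X \<in> faces m p - {{}}. snd (first_vertex X) = e}" for e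
  have step: "sum F (A (Suc e)) = sum F (A e)" if e: "Suc e < p" for e
  proof -
    have "image (rot p) ` A e = A (Suc e)"
    proof
      show "image (rot p) ` A e \<subseteq> A (Suc e)"
      proof
        fix Z assume "Z \<in> image (rot p) ` A e"
        then obtain X where X: "Z = rot p ` X" "X \<in> faces m p" "X \<noteq> {}" "snd (first_vertex X) = e"
          unfolding A_def by blast
        then show "Z \<in> A (Suc e)"
          using e first_vertex_rot[OF X(2,3)] rot_face[OF X(2)] unfolding A_def by simp
      qed
      show "A (Suc e) \<subseteq> image (rot p) ` A e"
      proof
        fix X assume X: "X \<in> A (Suc e)"
        then obtain Z where Z: "Z \<in> faces m p" "X = rot p ` Z"
          using rot_faces[of p m] unfolding A_def by blast
        with X have Z0: "Z \<noteq> {}" unfolding A_def by auto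
        have "snd (first_vertex Z) < p"
          using first_vertex(1)[OF Z(1) Z0] Z(1) unfolding faces_def by auto
        moreover have "(snd (first_vertex Z) + 1) mod p = Suc e"
          using X first_vertex_rot[OF Z(1) Z0] unfolding A_def Z(2) by simp
        ultimately have "snd (first_vertex Z) = e"
          by (auto simp: mod_Suc split: if_splits)
        with Z Z0 show "X \<in> image (rot p) ` A e" unfolding A_def by auto
      qed
    qed
    moreover have "inj_on (image (rot p)) (A e)"
      by (rule inj_on_subset[OF inj_on_image_Pow[OF inj_on_rot[of p m]]]) (auto simp: faces_def A_def)
    ultimately have "sum F (A (Suc e)) = (\<Sum>X\<in>A e. F (rot p ` X))"
      by (metis (no_types, lifting) sum.reindex_cong)
    also have "\<dots> = sum F (A e)" using inv by (intro sum.cong) (auto simp: A_def)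
    finally show ?thesis .
  qed
  have const: "sum F (A e) = sum F (A 0)" if "e < p" for e
    using that by (induction e) (auto simp: step)
  have "(\<Sum>X\<in>faces m p - {{}}. F X) = (\<Sum>e<p. sum F (A e))"
  proof -
    have "snd (first_vertex X) < p" if "X \<in> faces m p" "X \<noteq> {}" for X
      using first_vertex(1)[OF that] that(1) unfolding faces_def by auto
    then have "(\<lambda>X. snd (first_vertex X)) ` (faces m p - {{}}) \<subseteq> {..<p}" by auto
    then show ?thesis
      using sum.group[of "faces m p - {{}}" "{..<p}" "\<lambda>X. snd (first_vertex X)" F] finite_faces[of m p]
      unfolding A_def by simp
  qed
  also have "\<dots> = (\<Sum>e<p. sum F (A 0))" by (rule sum.cong[OF refl]) (rule const, simp)
  also have "\<dots> = int p * sum F (A 0)" by simp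
  finally show ?thesis by (rule dvdI)
qed

section \<open>Equivariant labellings do not lower the dimension\<close>

locale equivariant_labelling = monotone_labelling +
  assumes lab_rot: "X \<in> faces n p \<Longrightarrow> X \<noteq> {} \<Longrightarrow> lab (rot p ` X) = rot p (lab X)"
begin

lemma coef_rot:
  assumes "X \<in> faces n p" "card X = k" "Y \<subseteq> {..<m} \<times> {..<p}"
  shows "coef k (rot p ` X) (rot p ` Y) = coef k X Y"
  using assms
proof (induction k arbitrary: X Y)
  case 0
  then show ?case by simp
next
  case (Suc k)
  let ?t = "lab X"
  have X: "X \<in> faces n p" "X \<noteq> {}" "finite X" using Suc.prems finite_face by auto
  have t: "?t \<in> {..<m} \<times> {..<p}" using lab_in[OF X(1,2)] .
  have XV: "X \<subseteq> {..<n} \<times> {..<p}" using X(1) unfolding faces_def by auto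
  have Yt: "rot p ` Y - {rot p ?t} = rot p ` (Y - {?t})"
    using inj_on_image_set_diff[OF inj_on_rot[of p m], of Y "{?t}"] Suc.prems(3) t by auto
  have cY: "card (rot p ` (Y - {?t})) = card (Y - {?t})"
    using Suc.prems(3) by (intro card_image inj_on_subset[OF inj_on_rot[of p m]]) auto
  have "(\<Sum>x\<in>rot p ` X. osign (rot p ` X) x * coef k (rot p ` X - {x}) (rot p ` (Y - {?t})))
      = (\<Sum>x\<in>X. osign (rot p ` X) (rot p x) * coef k (rot p ` X - {rot p x}) (rot p ` (Y - {?t})))"
    using inj_on_subset[OF inj_on_rot XV] by (simp add: sum.reindex)
  also have "\<dots> = (\<Sum>x\<in>X. osign X x * coef k (X - {x}) (Y - {?t}))"
  proof (rule sum.cong[OF refl])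
    fix x assume x: "x \<in> X"
    have "rot p ` X - {rot p x} = rot p ` (X - {x})"
      using inj_on_image_set_diff[OF inj_on_rot[of p n], of X "{x}"] XV x by auto
    moreover have "coef k (rot p ` (X - {x})) (rot p ` (Y - {?t})) = coef k (X - {x}) (Y - {?t})"
      using Suc.prems x X(3) by (intro Suc.IH faces_subset[OF X(1)]) auto
    ultimately show "osign (rot p ` X) (rot p x) * coef k (rot p ` X - {rot p x}) (rot p ` (Y - {?t}))
        = osign X x * coef k (X - {x}) (Y - {?t})"
      by (simp add: osign_rot[OF XV])
  qed
  finally show ?case
    using top_vertex_rot[OF Suc.prems(3) t] by (simp add: lab_rot[OF X(1,2)] Yt cY)
qed

text \<open>
  The case of Dold's theorem for joins of copies of \<open>\<int>\<^sub>p\<close> and maps that are monotone in the levels.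
  For \<open>m < n\<close> the alternating trace of the chain map would be \<open>0\<close> by the homotopy but \<open>1\<close> modulo \<open>p\<close> by
  equivariance.
\<close>

theorem dimension_le:
  assumes "1 < p"
  shows "n \<le> m"
proof (rule ccontr)
  assume "\<not> n \<le> m"
  then have mn: "m < n" by simp
  let ?F = "\<lambda>X. (-1) ^ card X * coef (card X) X X :: int"
  have "int p dvd sum ?F (faces m p - {{}})"
  proof (rule sum_faces_mod)
    fix X assume X: "X \<in> faces m p"
    then have V: "X \<subseteq> {..<m} \<times> {..<p}" and Xn: "X \<in> faces n p"
      using faces_mono[of m n p] mn unfolding faces_def by auto
    have "card (rot p ` X) = card X"
      by (rule card_image[OF inj_on_subset[OF inj_on_rot V]])
    then show "?F (rot p ` X) = ?F X"
      using coef_rot[OF Xn refl V] by simp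
  qed
  moreover have "{} \<in> faces m p" unfolding faces_def by simp
  then have "sum ?F (faces m p) = 1 + sum ?F (faces m p - {{}})"
    using finite_faces by (subst sum.remove[of _ "{}"]) auto
  moreover have "sum ?F (faces m p) = 0" using trace_eq_0[OF mn] assms by simp
  ultimately have "sum ?F (faces m p - {{}}) = - 1" and dvd: "int p dvd sum ?F (faces m p - {{}})"
    by linarith+
  then have "int p dvd 1" using dvd by (simp only: dvd_minus_iff)
  then show False using assms by simp
qed

end

text \<open>
  For a set of signs whose size is prime to \<open>p\<close>, this is the arithmetic mean in \<open>\<int>\<^sub>p\<close>: the chosen \<open>u\<close> is
  the inverse of the size. It selects a sign from a set compatibly with rotation.
\<close>

definition mean_sign :: "nat \<Rightarrow> nat set \<Rightarrow> nat" where
  "mean_sign p A = (SOME u. [u * card A = 1] (mod p)) * \<Sum>A mod p"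

definition shift :: "nat \<Rightarrow> nat set \<Rightarrow> nat set" where
  "shift p A = (\<lambda>e. (e + 1) mod p) ` A"

lemma card_shift: "A \<subseteq> {..<p} \<Longrightarrow> card (shift p A) = card A"
  unfolding shift_def by (rule card_image[OF inj_on_subset[OF inj_on_rotate]])

lemma mean_sign_shift:
  assumes p: "prime p" and A: "A \<subseteq> {..<p}" "A \<noteq> {}" "A \<noteq> {..<p}"
  shows "mean_sign p (shift p A) = (mean_sign p A + 1) mod p"
proof -
  define u where "u = (SOME u. [u * card A = 1] (mod p))"
  have finA: "finite A" using A(1) finite_subset by blast
  have "card A < p" using A psubset_card_mono[of "{..<p}" A] by auto
  moreover have "0 < card A" using A(2) finA by (simp add: card_gt_0_iff)
  ultimately have "\<not> p dvd card A" by (simp add: nat_dvd_not_less)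
  then have "coprime p (card A)" by (rule prime_imp_coprime[OF p])
  then have "coprime (card A) p" by (simp only: coprime_commute)
  then obtain u' where "[card A * u' = 1] (mod p)" using cong_solve_coprime_nat by auto
  then have "[u' * card A = 1] (mod p)" by (simp only: mult.commute)
  then have u: "[u * card A = 1] (mod p)"
    unfolding u_def by (rule someI)
  have "[\<Sum>(shift p A) = (\<Sum>e\<in>A. e + 1)] (mod p)"
    unfolding shift_def cong_def
    by (subst sum.reindex[OF inj_on_subset[OF inj_on_rotate A(1)]]) (simp add: mod_sum_eq o_def)
  also have "(\<Sum>e\<in>A. e + 1) = \<Sum>A + card A"
    by (simp only: sum.distrib card_eq_sum)
  finally have "[u * \<Sum>(shift p A) = u * (\<Sum>A + card A)] (mod p)"
    by (intro cong_mult cong_refl)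
  also have "u * (\<Sum>A + card A) = u * \<Sum>A + u * card A" by (simp add: distrib_left)
  also have "[\<dots> = u * \<Sum>A + 1] (mod p)" by (intro cong_add cong_refl u)
  finally have "u * \<Sum>(shift p A) mod p = (u * \<Sum>A + 1) mod p"
    by (simp only: cong_def)
  moreover have "mean_sign p A = u * \<Sum>A mod p" "mean_sign p (shift p A) = u * \<Sum>(shift p A) mod p"
    by (simp_all only: mean_sign_def u_def card_shift[OF A(1)])
  ultimately show ?thesis by (simp add: mod_Suc_eq)
qed

text \<open>
  It suffices to label by nonempty proper sets of signs instead of single signs, since for prime \<open>p\<close>
  such a set has a mean. This is the form in which the labels arise from colorings.
\<close>

theorem no_equivariant_sign_sets:
  fixes lev :: "(nat \<times> nat) set \<Rightarrow> nat" and sgs :: "(nat \<times> nat) set \<Rightarrow> nat set"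
  assumes p: "prime p"
    and lev: "\<And>X. X \<in> faces n p \<Longrightarrow> X \<noteq> {} \<Longrightarrow> lev X < m"
    and sgs: "\<And>X. X \<in> faces n p \<Longrightarrow> X \<noteq> {} \<Longrightarrow> sgs X \<subset> {..<p} \<and> sgs X \<noteq> {}"
    and mono: "\<And>X Y. Y \<in> faces n p \<Longrightarrow> X \<noteq> {} \<Longrightarrow> X \<subseteq> Y \<Longrightarrow>
      lev X < lev Y \<or> lev X = lev Y \<and> sgs X = sgs Y"
    and lev_rot: "\<And>X. X \<in> faces n p \<Longrightarrow> X \<noteq> {} \<Longrightarrow> lev (rot p ` X) = lev X"
    and sgs_rot: "\<And>X. X \<in> faces n p \<Longrightarrow> X \<noteq> {} \<Longrightarrow> sgs (rot p ` X) = shift p (sgs X)"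
  shows "n \<le> m"
proof -
  have p1: "1 < p" using p prime_gt_1_nat by auto
  interpret equivariant_labelling n m p "\<lambda>X. (lev X, mean_sign p (sgs X))"
  proof
    fix X assume X: "X \<in> faces n p" "X \<noteq> {}"
    show "(lev X, mean_sign p (sgs X)) \<in> {..<m} \<times> {..<p}"
      using lev[OF X] p1 unfolding mean_sign_def by auto
    show "(lev (rot p ` X), mean_sign p (sgs (rot p ` X))) = rot p (lev X, mean_sign p (sgs X))"
      using sgs[OF X] mean_sign_shift[OF p, of "sgs X"]
      by (intro prod_eqI) (auto simp: lev_rot[OF X] sgs_rot[OF X])
  next
    fix X Y :: "(nat \<times> nat) set" assume "Y \<in> faces n p" "X \<noteq> {}" "X \<subseteq> Y"
    from mono[OF this]
    show "fst (lev X, mean_sign p (sgs X)) < fst (lev Y, mean_sign p (sgs Y))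
        \<or> (lev X, mean_sign p (sgs X)) = (lev Y, mean_sign p (sgs Y))"
      by auto
  qed
  show ?thesis by (rule dimension_le[OF p1])
qed

section \<open>Balanced subfamilies\<close>

text \<open>
  For a family of sets \<open>K 0, \<dots>, K (p - 1)\<close>, consider subfamilies \<open>U e \<subseteq> K e\<close> whose sizes differ pairwise by
  at most one. A largest one takes \<open>least_size + 1\<close> elements from the sets that are larger than the
  smallest and \<open>least_size\<close> elements from the rest, so its total size is \<open>balance\<close>.
\<close>

definition least_size :: "nat \<Rightarrow> (nat \<Rightarrow> nat set) \<Rightarrow> nat" where
  "least_size p K = Min ((\<lambda>e. card (K e)) ` {..<p})"

definition surplus :: "nat \<Rightarrow> (nat \<Rightarrow> nat set) \<Rightarrow> nat set" where
  "surplus p K = {e \<in> {..<p}. least_size p K < card (K e)}"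

definition balance :: "nat \<Rightarrow> (nat \<Rightarrow> nat set) \<Rightarrow> nat" where
  "balance p K = p * least_size p K + card (surplus p K)"

text \<open>
  If all the sets have the same size, no set stands out by its size. The indices of the sets that
  contain the least element of the union then replace the indices of the large sets.
\<close>

definition sign_set :: "nat \<Rightarrow> (nat \<Rightarrow> nat set) \<Rightarrow> nat set" where
  "sign_set p K = (if surplus p K \<noteq> {} then surplus p K
     else {e \<in> {..<p}. (LEAST j. \<exists>e<p. j \<in> K e) \<in> K e})"

lemma least_size_le: "e < p \<Longrightarrow> least_size p K \<le> card (K e)"
  unfolding least_size_def by (intro Min_le) auto

lemma least_size_attained: "0 < p \<Longrightarrow> \<exists>e<p. card (K e) = least_size p K"
  using Min_in[of "(\<lambda>e. card (K e)) ` {..<p}"] unfolding least_size_def by fastforce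

lemma finite_surplus [simp]: "finite (surplus p K)"
  unfolding surplus_def by simp

lemma surplus_psubset: "0 < p \<Longrightarrow> surplus p K \<subset> {..<p}"
proof -
  assume "0 < p"
  then obtain e where "e < p" "card (K e) = least_size p K" using least_size_attained by blast
  then have "e \<in> {..<p}" "e \<notin> surplus p K" unfolding surplus_def by auto
  moreover have "surplus p K \<subseteq> {..<p}" unfolding surplus_def by blast
  ultimately show ?thesis by blast
qed

lemma card_surplus_less: "0 < p \<Longrightarrow> card (surplus p K) < p"
  using psubset_card_mono[OF _ surplus_psubset] by simp

text \<open>
  If \<open>K \<subseteq> L\<close> have the same balance, division by \<open>p\<close> shows that \<open>least_size\<close> and the number of large sets
  agree, so the same sets are large. When no set is large, all sizes agree and \<open>K = L\<close>.
\<close>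

lemma balance_mono:
  assumes p: "0 < p" and sub: "\<And>e. e < p \<Longrightarrow> K e \<subseteq> L e" and fin: "\<And>e. e < p \<Longrightarrow> finite (L e)"
  shows "balance p K < balance p L \<or> balance p K = balance p L \<and> sign_set p K = sign_set p L"
proof -
  have le: "card (K e) \<le> card (L e)" if "e < p" for e
    using card_mono[OF fin sub] that by blast
  obtain e where e: "e < p" "card (L e) = least_size p L"
    using least_size_attained[OF p] by blast
  have ll: "least_size p K \<le> least_size p L"
    using least_size_le[OF e(1), of K] le[OF e(1)] e(2) by simp
  show ?thesis
  proof (cases "least_size p K = least_size p L")
    case False
    with ll have "Suc (least_size p K) \<le> least_size p L" by simp
    then have "p * Suc (least_size p K) \<le> p * least_size p L" by (rule mult_le_mono2)
    then show ?thesis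
      using card_surplus_less[OF p, of K] unfolding balance_def by simp
  next
    case True
    have ss: "surplus p K \<subseteq> surplus p L"
      unfolding surplus_def True using le by (auto intro: less_le_trans)
    show ?thesis
    proof (cases "surplus p K = surplus p L")
      case False
      then have "card (surplus p K) < card (surplus p L)"
        using ss by (intro psubset_card_mono) auto
      then show ?thesis unfolding balance_def True by simp
    next
      case eq: True
      have "sign_set p K = sign_set p L"
      proof (cases "surplus p K = {}")
        case False
        then show ?thesis using eq unfolding sign_set_def by simp
      next
        case empty: True
        have "K e = L e" if "e < p" for e
        proof (rule card_subset_eq[OF fin[OF that] sub[OF that]])
          have "card (K e) = least_size p K" "card (L e) = least_size p L"
            using empty eq that least_size_le[OF that, of K] least_size_le[OF that, of L]
            unfolding surplus_def by fastforce+
          then show "card (K e) = card (L e)" using True by simp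
        qed
        then have "(\<exists>e<p. j \<in> K e) \<longleftrightarrow> (\<exists>e<p. j \<in> L e)"
            "{e \<in> {..<p}. j \<in> K e} = {e \<in> {..<p}. j \<in> L e}" for j
          by auto
        then show ?thesis unfolding sign_set_def eq by simp
      qed
      then show ?thesis unfolding balance_def True eq by simp
    qed
  qed
qed

lemma rotate_onto: "(\<lambda>e. (e + 1) mod p) ` {..<p :: nat} = {..<p}"
  by (rule endo_inj_surj[OF _ _ inj_on_rotate]) auto

lemma shift_Collect:
  assumes "\<And>e. e < p \<Longrightarrow> Q ((e + 1) mod p) \<longleftrightarrow> P e"
  shows "{e \<in> {..<p}. Q e} = shift p {e \<in> {..<p}. P e}"
proof -
  have "{e \<in> {..<p}. Q e} = {e \<in> (\<lambda>e. (e + 1) mod p) ` {..<p}. Q e}"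
    unfolding rotate_onto ..
  also have "\<dots> = (\<lambda>e. (e + 1) mod p) ` {e \<in> {..<p}. Q ((e + 1) mod p)}"
    by blast
  also have "{e \<in> {..<p}. Q ((e + 1) mod p)} = {e \<in> {..<p}. P e}"
    using assms by auto
  finally show ?thesis unfolding shift_def .
qed

lemma balance_shift:
  assumes rot: "\<And>e. e < p \<Longrightarrow> L ((e + 1) mod p) = K e"
  shows "balance p L = balance p K" "sign_set p L = shift p (sign_set p K)"
proof -
  have "(\<lambda>e. card (L e)) ` {..<p} = (\<lambda>e. card (L e)) ` (\<lambda>e. (e + 1) mod p) ` {..<p}"
    unfolding rotate_onto ..
  also have "\<dots> = (\<lambda>e. card (K e)) ` {..<p}"
    unfolding image_image by (rule image_cong[OF refl]) (use rot in auto)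
  finally have ls: "least_size p L = least_size p K" unfolding least_size_def by simp
  have sp: "surplus p L = shift p (surplus p K)"
    unfolding surplus_def ls by (rule shift_Collect) (use rot in simp)
  have "card (surplus p L) = card (surplus p K)"
    unfolding sp by (rule card_shift) (auto simp: surplus_def)
  then show "balance p L = balance p K" unfolding balance_def ls by simp
  have ex: "(\<exists>e<p. j \<in> L e) \<longleftrightarrow> (\<exists>e<p. j \<in> K e)" for j
  proof -
    have "(\<exists>e\<in>{..<p}. j \<in> L e) \<longleftrightarrow> (\<exists>e\<in>(\<lambda>e. (e + 1) mod p) ` {..<p}. j \<in> L e)"
      unfolding rotate_onto ..
    also have "\<dots> \<longleftrightarrow> (\<exists>e\<in>{..<p}. j \<in> K e)"
      using rot by simp
    finally show ?thesis by auto
  qed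
  have "{e \<in> {..<p}. j \<in> L e} = shift p {e \<in> {..<p}. j \<in> K e}" for j
    by (rule shift_Collect) (use rot in simp)
  moreover have "surplus p L = {} \<longleftrightarrow> surplus p K = {}" unfolding sp shift_def by simp
  ultimately show "sign_set p L = shift p (sign_set p K)"
    unfolding sign_set_def ex sp[symmetric] by (simp add: sp)
qed

lemma sign_set_proper:
  assumes p: "0 < p" and ne: "\<exists>e<p. K e \<noteq> {}" and miss: "\<And>j. \<exists>e<p. j \<notin> K e"
  shows "sign_set p K \<subset> {..<p}" "sign_set p K \<noteq> {}"
proof -
  let ?j = "LEAST j. \<exists>e<p. j \<in> K e"
  have "\<exists>e<p. ?j \<in> K e" by (rule LeastI_ex) (use ne in blast)
  then show "sign_set p K \<noteq> {}" unfolding sign_set_def by auto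
  show "sign_set p K \<subset> {..<p}"
    using surplus_psubset[OF p, of K] miss[of ?j] unfolding sign_set_def by auto
qed

lemma balance_pos:
  assumes p: "0 < p" and e: "e < p" "K e \<noteq> {}" "finite (K e)"
  shows "0 < balance p K"
proof (cases "least_size p K")
  case 0
  then have "e \<in> surplus p K" using e unfolding surplus_def by (simp add: card_gt_0_iff)
  then have "0 < card (surplus p K)" by (simp add: card_gt_0_iff) blast
  then show ?thesis unfolding balance_def by simp
next
  case (Suc k)
  then show ?thesis using p unfolding balance_def by simp
qed

lemma balance_le_sum:
  "balance p K \<le> (\<Sum>e<p. card (K e))"
proof -
  have "balance p K = (\<Sum>e<p. least_size p K + (if e \<in> surplus p K then 1 else 0))"
    unfolding balance_def sum.distrib by (simp add: surplus_def sum.If_cases Int_def)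
  also have "\<dots> \<le> (\<Sum>e<p. card (K e))"
    by (rule sum_mono) (use least_size_le[of _ p K] in \<open>auto simp: surplus_def\<close>)
  finally show ?thesis .
qed

lemma balance_ge_imp_nonempty:
  assumes "p \<le> balance p K" "e < p"
  shows "K e \<noteq> {}"
proof
  assume "K e = {}"
  then have "least_size p K = 0" using least_size_le[OF assms(2), of K] by simp
  then show False
    using assms card_surplus_less[of p K] unfolding balance_def by simp
qed

section \<open>Colors inside the parts of a vector\<close>

text \<open>
  The numbering \<open>v\<close> of the vertices turns a face into disjoint sets \<open>part X e\<close> of vertices of \<open>H\<close>.
\<close>

locale kneser_coloring =
  fixes H :: "'a hypergraph" and p t :: nat and c :: "'a set \<Rightarrow> nat"
    and v :: "nat \<Rightarrow> 'a"
  assumes hyp: "hypergraph H" and no_empty: "{} \<notin> edges H" and prime: "prime p"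
    and proper: "proper_coloring (kneser p H) t c"
    and v: "bij_betw v {..<card (verts H)} (verts H)"
begin

abbreviation "n \<equiv> card (verts H)"

definition part :: "(nat \<times> nat) set \<Rightarrow> nat \<Rightarrow> 'a set" where
  "part X e = v ` {i. (i, e) \<in> X}"

definition colors :: "(nat \<times> nat) set \<Rightarrow> nat \<Rightarrow> nat set" where
  "colors X e = c ` {E \<in> edges H. E \<subseteq> part X e}"

lemma p_gt_1: "1 < p" using prime by (rule prime_gt_1_nat)

lemma finite_edges: "finite (edges H)"
  using hyp finite_subset unfolding hypergraph_def by auto

lemma finite_colors: "finite (colors X e)"
  unfolding colors_def using finite_edges by simp

lemma colors_mono: "X \<subseteq> Y \<Longrightarrow> colors X e \<subseteq> colors Y e"
  unfolding colors_def part_def by blast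

lemma part_disjoint:
  assumes X: "X \<in> faces n p" and "e \<noteq> e'"
  shows "part X e \<inter> part X e' = {}"
proof (rule ccontr)
  assume "part X e \<inter> part X e' \<noteq> {}"
  then obtain i j where ij: "(i, e) \<in> X" "(j, e') \<in> X" "v i = v j"
    unfolding part_def by auto
  then have "i = j"
    using X bij_betw_imp_inj_on[OF v] unfolding faces_def inj_on_def by blast
  with ij X assms(2) show False unfolding faces_def inj_on_def by fastforce
qed

lemma part_rot:
  assumes X: "X \<in> faces n p" and e: "e < p"
  shows "part (rot p ` X) ((e + 1) mod p) = part X e"
proof -
  have "(i, (e + 1) mod p) \<in> rot p ` X \<longleftrightarrow> (i, e) \<in> X" for i
  proof
    assume "(i, (e + 1) mod p) \<in> rot p ` X"
    then obtain f where f: "(i, f) \<in> X" "(f + 1) mod p = (e + 1) mod p"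
      unfolding rot_def by auto
    then have "f < p" using X unfolding faces_def by auto
    then have "f = e" using inj_onD[OF inj_on_rotate f(2)] e by simp
    with f show "(i, e) \<in> X" by simp
  next
    assume "(i, e) \<in> X"
    then have "rot p (i, e) \<in> rot p ` X" by (rule imageI)
    then show "(i, (e + 1) mod p) \<in> rot p ` X" by (simp add: rot_def)
  qed
  then show ?thesis unfolding part_def by simp
qed

lemma colors_rot:
  "X \<in> faces n p \<Longrightarrow> e < p \<Longrightarrow> colors (rot p ` X) ((e + 1) mod p) = colors X e"
  unfolding colors_def using part_rot by simp

lemma kneser_edge:
  assumes X: "X \<in> faces n p" and g: "\<And>e. e < p \<Longrightarrow> g e \<in> edges H \<and> g e \<subseteq> part X e"
  shows "g ` {..<p} \<in> edges (kneser p H)"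
proof -
  let ?f = "\<lambda>i. g (i - 1)"
  have "?f ` {1..p} = g ` (\<lambda>i. i - 1) ` {1..p}" by (simp add: image_image)
  also have "(\<lambda>i. i - 1) ` {1..p} = {..<p}"
  proof
    show "{..<p} \<subseteq> (\<lambda>i. i - 1) ` {1..p}"
    proof
      fix e assume "e \<in> {..<p}"
      then show "e \<in> (\<lambda>i. i - 1) ` {1..p}" by (intro image_eqI[of _ _ "Suc e"]) auto
    qed
  qed auto
  finally have eq: "g ` {..<p} = ?f ` {1..p}" ..
  have "?f i \<inter> ?f j = {}" if "i \<in> {1..p}" "j \<in> {1..p}" "i \<noteq> j" for i j
  proof -
    have "i - 1 < p" "j - 1 < p" "i - 1 \<noteq> j - 1" using that by auto
    then show ?thesis using g part_disjoint[OF X, of "i - 1" "j - 1"] by blast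
  qed
  moreover have "?f \<in> {1..p} \<rightarrow> edges H" using g by auto
  ultimately have "\<exists>f. g ` {..<p} = f ` {1..p} \<and> f \<in> {1..p} \<rightarrow> edges H \<and>
      (\<forall>i\<in>{1..p}. \<forall>j\<in>{1..p}. i \<noteq> j \<longrightarrow> f i \<inter> f j = {})"
    using eq by (intro exI[of _ ?f]) blast
  then show ?thesis unfolding kneser_def by simp
qed

text \<open>
  Edges of one color in all \<open>p\<close> parts would be a monochromatic edge of the Kneser hypergraph.
\<close>

lemma color_missing:
  assumes X: "X \<in> faces n p"
  shows "\<exists>e<p. j \<notin> colors X e"
proof (rule ccontr)
  assume "\<not> ?thesis"
  then have "\<forall>e. \<exists>E. e < p \<longrightarrow> E \<in> edges H \<and> E \<subseteq> part X e \<and> c E = j"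
    unfolding colors_def by blast
  then obtain g where g: "\<And>e. e < p \<Longrightarrow> g e \<in> edges H \<and> g e \<subseteq> part X e \<and> c (g e) = j"
    by metis
  then have "g ` {..<p} \<in> edges (kneser p H)" by (intro kneser_edge[OF X]) auto
  moreover have "c ` g ` {..<p} = {j}"
    using g p_gt_1 by (auto simp: image_image image_iff intro!: bexI[of _ 0])
  ultimately show False
    using proper unfolding proper_coloring_def by fastforce
qed

lemma card_part_union:
  assumes "X \<in> faces n p"
  shows "card (v ` fst ` X) = card X" "v ` fst ` X \<subseteq> verts H"
proof -
  have sub: "fst ` X \<subseteq> {..<n}" and inj: "inj_on fst X" using assms unfolding faces_def by auto
  then have "card (v ` fst ` X) = card (fst ` X)"
    using inj_on_subset[OF bij_betw_imp_inj_on[OF v]] by (intro card_image) auto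
  also have "\<dots> = card X" by (rule card_image[OF inj])
  finally show "card (v ` fst ` X) = card X" .
  show "v ` fst ` X \<subseteq> verts H" using sub bij_betw_imp_surj_on[OF v] by blast
qed

text \<open>
  If no part contains an edge, the parts are the color classes of a proper coloring of \<open>H\<close> restricted
  to their union, so the complement of the union is among the sets over which the defect is minimized.
\<close>

lemma colorability_defect_le:
  assumes X: "X \<in> faces n p" and free: "\<forall>e<p. colors X e = {}"
  shows "colorability_defect p H \<le> n - card X"
proof -
  let ?S = "v ` fst ` X" and ?Y = "verts H - v ` fst ` X"
  have finV: "finite (verts H)" using hyp unfolding hypergraph_def by blast
  define col where "col w = (SOME k. \<exists>e<p. k = Suc e \<and> w \<in> part X e)" for w
  have col: "\<exists>e<p. col w = Suc e \<and> w \<in> part X e" if "w \<in> ?S" for w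
  proof -
    obtain i e where "(i, e) \<in> X" "w = v i" using \<open>w \<in> ?S\<close> by auto
    then have "e < p" "w \<in> part X e" using X unfolding faces_def part_def by auto
    then have "\<exists>k. \<exists>e<p. k = Suc e \<and> w \<in> part X e" by blast
    then show ?thesis unfolding col_def by (rule someI_ex)
  qed
  have "proper_coloring (induced H ?S) p col"
    unfolding proper_coloring_def coloring_def
  proof (intro conjI notI)
    show "0 < p" using p_gt_1 by simp
    show "col \<in> verts (induced H ?S) \<rightarrow> {1..p}"
      unfolding induced_def using col by fastforce
    assume "\<exists>E\<in>edges (induced H ?S). card (col ` E) = 1"
    then obtain E k where E: "E \<in> edges H" "E \<subseteq> ?S" "col ` E = {k}"
      unfolding induced_def by (auto simp: card_1_singleton_iff)
    then obtain w where "w \<in> E" by blast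
    then have "w \<in> ?S" "col w = k" using E(2,3) by auto
    then obtain e where e: "e < p" "k = Suc e" using col[of w] by auto
    have "E \<subseteq> part X e"
    proof
      fix w assume w: "w \<in> E"
      then have "col w = Suc e" using E e by blast
      with w E(2) col[of w] show "w \<in> part X e" by auto
    qed
    then have "colors X e \<noteq> {}" using E unfolding colors_def by blast
    with free e show False by blast
  qed
  then have "chromatic_number (induced H ?S) \<le> enat p"
    using chromatic_number_le_iff[of p "induced H ?S"] p_gt_1 by auto
  moreover have "verts H - ?Y = ?S" using card_part_union(2)[OF X] by blast
  ultimately have "card ?Y \<in> {card Y | Y. Y \<subseteq> verts H \<and>
      chromatic_number (induced H (verts H - Y)) \<le> enat p}"
    by (intro CollectI exI[of _ ?Y]) simp
  moreover have "finite {card Y | Y. Y \<subseteq> verts H \<and> chromatic_number (induced H (verts H - Y)) \<le> enat p}"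
    by (rule finite_subset[of _ "card ` Pow (verts H)"]) (use finV in auto)
  ultimately have "colorability_defect p H \<le> card ?Y"
    unfolding colorability_defect_def by (rule Min_le[rotated])
  also have "card ?Y = n - card X"
    using card_part_union[OF X] finV by (simp add: card_Diff_subset finite_subset)
  finally show ?thesis .
qed

text \<open>
  If all balances were below the defect \<open>d\<close>, the levels below would stay under \<open>n - 1\<close>, against
  \<open>no_equivariant_sign_sets\<close>. Monotonicity between the two kinds of faces holds because a face whose
  parts contain no edges has at most \<open>n - d\<close> vertices and the other levels start at \<open>n - d\<close>.
\<close>

theorem ex_balanced:
  assumes "0 < colorability_defect p H"
  shows "\<exists>X\<in>faces n p. colorability_defect p H \<le> balance p (colors X)"
proof (rule ccontr)
  let ?d = "colorability_defect p H"
  assume "\<not> ?thesis"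
  then have small: "balance p (colors X) < ?d" if "X \<in> faces n p" for X
    using that by (meson not_le)
  have p: "0 < p" using p_gt_1 by simp
  have dn: "?d \<le> n" using colorability_defect_le[of "{}"] no_empty
    unfolding faces_def colors_def part_def by simp
  \<comment> \<open>Sizes and balances are positive; subtracting 1 makes the levels start at 0 without a gap.\<close>
  define free where "free X \<longleftrightarrow> (\<forall>e<p. colors X e = {})" for X
  define lev where "lev X = (if free X then card X - 1 else n - ?d + balance p (colors X) - 1)" for X
  define sgs where "sgs X = (if free X then {snd (first_vertex X)} else sign_set p (colors X))" for X
  have cardX: "0 < card X" "card X \<le> n - ?d" if "X \<in> faces n p" "X \<noteq> {}" "free X" for X
  proof -
    show "0 < card X" using that finite_face[OF that(1)] by (simp add: card_gt_0_iff)
    have "card X \<le> n"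
      using card_part_union[OF that(1)] hyp card_mono unfolding hypergraph_def by metis
    moreover have "?d \<le> n - card X"
      using colorability_defect_le[OF that(1)] that(3) unfolding free_def by blast
    ultimately show "card X \<le> n - ?d" by linarith
  qed
  have pos: "0 < balance p (colors X)" if "\<not> free X" for X
    using that balance_pos[OF p, where K = "colors X"] finite_colors unfolding free_def by blast
  have free_rot: "free (rot p ` X) \<longleftrightarrow> free X" if X: "X \<in> faces n p" for X
  proof -
    have "(\<forall>e\<in>(\<lambda>e. (e + 1) mod p) ` {..<p}. colors (rot p ` X) e = {}) \<longleftrightarrow> (\<forall>e\<in>{..<p}. colors X e = {})"
      using colors_rot[OF X] by simp
    then show ?thesis unfolding rotate_onto free_def by auto
  qed
  have "n \<le> n - 1"
  proof (rule no_equivariant_sign_sets[OF prime, where lev = lev and sgs = sgs])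
    fix X assume X: "X \<in> faces n p" "X \<noteq> {}"
    show "lev X < n - 1"
      using cardX[OF X] small[OF X(1)] pos[of X] dn assms unfolding lev_def by (cases "free X") auto
    have "snd (first_vertex X) < p"
      using first_vertex(1)[OF X] X(1) unfolding faces_def by auto
    moreover have "{snd (first_vertex X)} \<noteq> {..<p}"
    proof
      assume "{snd (first_vertex X)} = {..<p}"
      then have "card {snd (first_vertex X)} = card {..<p}" by (rule arg_cong)
      then show False using p_gt_1 by simp
    qed
    moreover have "\<exists>e<p. colors X e \<noteq> {}" if "\<not> free X" using that unfolding free_def by blast
    ultimately show "sgs X \<subset> {..<p} \<and> sgs X \<noteq> {}"
      using sign_set_proper[OF p _ color_missing[OF X(1)]] unfolding sgs_def by auto
    have "card (rot p ` X) = card X"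
      using X(1) by (intro card_image inj_on_subset[OF inj_on_rot[of p n]]) (auto simp: faces_def)
    then show "lev (rot p ` X) = lev X"
      using balance_shift(1)[of p "colors (rot p ` X)" "colors X"] colors_rot[OF X(1)] free_rot[OF X(1)]
      unfolding lev_def by simp
    show "sgs (rot p ` X) = shift p (sgs X)"
      using balance_shift(2)[of p "colors (rot p ` X)" "colors X"] colors_rot[OF X(1)] free_rot[OF X(1)]
      unfolding sgs_def by (simp add: first_vertex_rot[OF X] shift_def)
  next
    fix X Y :: "(nat \<times> nat) set"
    assume Y: "Y \<in> faces n p" and X0: "X \<noteq> {}" and sub: "X \<subseteq> Y"
    have X: "X \<in> faces n p" by (rule faces_subset[OF Y sub])
    have finY: "finite Y" using finite_face[OF Y] .
    show "lev X < lev Y \<or> lev X = lev Y \<and> sgs X = sgs Y"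
    proof (cases "free X"; cases "free Y")
      assume f: "free X" "free Y"
      show ?thesis
      proof (cases "X = Y")
        case False
        then have "card X < card Y" using sub finY by (intro psubset_card_mono) auto
        then show ?thesis using f cardX(1)[OF X X0] unfolding lev_def by auto
      qed simp
    next
      assume f: "free X" "\<not> free Y"
      then show ?thesis using cardX[OF X X0] pos[of Y] unfolding lev_def by auto
    next
      assume f: "\<not> free X" "free Y"
      then show ?thesis using colors_mono[OF sub] unfolding free_def by blast
    next
      assume f: "\<not> free X" "\<not> free Y"
      then show ?thesis
        using balance_mono[OF p, of "colors X" "colors Y"] colors_mono[OF sub] finite_colors
          pos[of X] pos[of Y]
        unfolding lev_def sgs_def by auto
    qed
  qed
  then show False using dn assms by linarith
qed

lemma max_local_colors_ge:
  assumes "e \<in> edges (kneser p H)" "E \<in> e"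
  shows "card (c ` closed_nbhd (kneser p H) (e - {E})) \<le> max_local_colors (kneser p H) c"
proof -
  let ?G = "kneser p H"
  have fin: "finite (edges ?G)"
    by (rule finite_subset[of _ "Pow (edges H)"]) (use finite_edges in \<open>auto simp: kneser_def\<close>)
  have "finite (\<Union>(edges ?G))" using finite_edges
    by (rule finite_subset[rotated]) (auto simp: kneser_def)
  then have "finite ((\<lambda>(e, E). card (c ` closed_nbhd ?G (e - {E}))) ` (edges ?G \<times> \<Union>(edges ?G)))"
    using fin by simp
  then have "finite {card (c ` closed_nbhd ?G (e - {E})) | e E. e \<in> edges ?G \<and> E \<in> e}"
    by (rule finite_subset[rotated]) auto
  then have "card (c ` closed_nbhd ?G (e - {E}))
      \<le> Max {card (c ` closed_nbhd ?G (e - {E})) | e E. e \<in> edges ?G \<and> E \<in> e}"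
    using assms by (intro Max_ge) auto
  then show ?thesis using assms(1) unfolding max_local_colors_def by auto
qed

lemma finite_closed_nbhd:
  "e \<in> edges (kneser p H) \<Longrightarrow> finite (closed_nbhd (kneser p H) (e - {E}))"
  by (rule finite_subset[OF _ finite_edges]) (auto simp: kneser_def closed_nbhd_def nbhd_def)

text \<open>
  In the edge formed by the \<open>g e\<close>, the vertex chosen in one part can be exchanged for any other edge
  of \<open>H\<close> inside that part.
\<close>

lemma closed_nbhd_transversal:
  assumes X: "X \<in> faces n p" and g: "\<And>e. e < p \<Longrightarrow> g e \<in> edges H \<and> g e \<subseteq> part X e" and e: "e < p"
  shows "{E \<in> edges H. E \<subseteq> part X e} \<union> g ` ({..<p} - {e})
    \<subseteq> closed_nbhd (kneser p H) (g ` {..<p} - {g e})"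
proof -
  have diff: "E \<noteq> g e'" if "E \<in> edges H" "E \<subseteq> part X e" "e' < p" "e' \<noteq> e" for E e'
  proof
    assume eq: "E = g e'"
    then have "E \<subseteq> part X e \<inter> part X e'" using that g by blast
    then have "E = {}" using part_disjoint[OF X, of e e'] that by auto
    then show False using that no_empty by blast
  qed
  have "E \<in> nbhd (kneser p H) (g ` {..<p} - {g e})" if E: "E \<in> edges H" "E \<subseteq> part X e" for E
  proof -
    let ?g = "g(e := E)"
    have "?g ` {..<p} \<in> edges (kneser p H)"
      using g E by (intro kneser_edge[OF X]) auto
    moreover have "?g ` {..<p} - (g ` {..<p} - {g e}) = {E}"
    proof
      show "{E} \<subseteq> ?g ` {..<p} - (g ` {..<p} - {g e})"
        using diff[OF E] e by force
      show "?g ` {..<p} - (g ` {..<p} - {g e}) \<subseteq> {E}"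
      proof
        fix x assume x: "x \<in> ?g ` {..<p} - (g ` {..<p} - {g e})"
        then obtain e' where e': "e' < p" "x = ?g e'" by auto
        show "x \<in> {E}"
        proof (cases "e' = e")
          case False
          then have "x = g e'" "g e \<noteq> g e'" using e' diff[of "g e" e'] g[OF e] by auto
          with x e' show ?thesis by auto
        qed (use e' in simp)
      qed
    qed
    ultimately show ?thesis
      using E unfolding nbhd_def kneser_def by auto
  qed
  moreover have "g ` ({..<p} - {e}) \<subseteq> g ` {..<p} - {g e}"
    using diff[of "g e"] g[OF e] by fastforce
  ultimately show ?thesis unfolding closed_nbhd_def by blast
qed

text \<open>
  Here \<open>k\<close> is the largest number of colors in a part. The sizes of the color sets add up to at least
  the defect. Counting each color by the parts that contain it improves the bound \<open>p k\<close> to \<open>(p - 1) k\<close>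
  when the largest color set contains all the others.
\<close>

theorem max_local_colors_lower_bound:
  assumes d: "p \<le> colorability_defect p H"
  shows "\<exists>k. colorability_defect p H \<le> p * k \<and> k + 1 \<le> max_local_colors (kneser p H) c
    \<or> colorability_defect p H \<le> (p - 1) * k \<and> k \<le> max_local_colors (kneser p H) c"
proof -
  let ?d = "colorability_defect p H" and ?M = "max_local_colors (kneser p H) c"
  have p: "0 < p" using p_gt_1 by simp
  obtain X where X: "X \<in> faces n p" "?d \<le> balance p (colors X)"
    using ex_balanced d p by auto
  have ne: "colors X e \<noteq> {}" if "e < p" for e
    using balance_ge_imp_nonempty[OF _ that] d X(2) by simp
  have d_le: "?d \<le> (\<Sum>e<p. card (colors X e))"
    using balance_le_sum[of p "colors X"] X(2) by simp
  have "\<exists>e\<in>{..<p}. card (colors X e) = Max ((\<lambda>e. card (colors X e)) ` {..<p})"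
    using Max_in[of "(\<lambda>e. card (colors X e)) ` {..<p}"] p by fastforce
  then obtain a where a: "a < p" "card (colors X a) = Max ((\<lambda>e. card (colors X e)) ` {..<p})"
    by blast
  let ?k = "card (colors X a)"
  have max: "card (colors X e) \<le> ?k" if "e < p" for e
    unfolding a(2) using that by (intro Max_ge) auto
  have bound: "card (colors X a \<union> c ` g ` ({..<p} - {a})) \<le> ?M"
    if g: "\<And>e. e < p \<Longrightarrow> g e \<in> edges H \<and> g e \<subseteq> part X e" for g
  proof -
    let ?N = "closed_nbhd (kneser p H) (g ` {..<p} - {g a})"
    have ed: "g ` {..<p} \<in> edges (kneser p H)" by (rule kneser_edge[OF X(1) g])
    have "colors X a \<union> c ` g ` ({..<p} - {a}) \<subseteq> c ` ?N"
      using closed_nbhd_transversal[OF X(1) g a(1)] unfolding colors_def by blast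
    then have "card (colors X a \<union> c ` g ` ({..<p} - {a})) \<le> card (c ` ?N)"
      using finite_closed_nbhd[OF ed] by (intro card_mono) auto
    also have "\<dots> \<le> ?M" by (rule max_local_colors_ge[OF ed]) (use a in auto)
    finally show ?thesis .
  qed
  have "\<forall>e. \<exists>E. e < p \<longrightarrow> E \<in> edges H \<and> E \<subseteq> part X e"
    using ne unfolding colors_def by blast
  then obtain g where g: "\<And>e. e < p \<Longrightarrow> g e \<in> edges H \<and> g e \<subseteq> part X e"
    by metis
  show ?thesis
  proof (cases "\<forall>e<p. colors X e \<subseteq> colors X a")
    case False
    then obtain b j where b: "b < p" "j \<in> colors X b" "j \<notin> colors X a" by blast
    then obtain E where E: "E \<in> edges H" "E \<subseteq> part X b" "c E = j"
      unfolding colors_def by blast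
    have ba: "b \<noteq> a" using b by blast
    \<comment> \<open>Choosing \<open>E\<close> in part \<open>b\<close> puts the additional color into the neighborhood.\<close>
    have "card (insert j (colors X a)) \<le> card (colors X a \<union> c ` (g(b := E)) ` ({..<p} - {a}))"
    proof (rule card_mono)
      show "insert j (colors X a) \<subseteq> colors X a \<union> c ` (g(b := E)) ` ({..<p} - {a})"
        using E b ba by (auto simp: image_iff intro!: bexI[of _ b])
    qed (simp add: finite_colors)
    also have "\<dots> \<le> ?M" by (rule bound) (use g E b in auto)
    finally have "?k + 1 \<le> ?M" using b(3) by (simp add: finite_colors)
    moreover have "?d \<le> p * ?k"
      using d_le sum_bounded_above[of "{..<p}" "\<lambda>e. card (colors X e)" ?k] max by simp
    ultimately show ?thesis by blast
  next
    case True
    have "?k \<le> card (colors X a \<union> c ` g ` ({..<p} - {a}))"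
      by (rule card_mono) (simp_all add: finite_colors)
    also have "\<dots> \<le> ?M" by (rule bound[OF g])
    finally have "?k \<le> ?M" .
    have "(\<Sum>e<p. card (colors X e)) = (\<Sum>e<p. \<Sum>j\<in>colors X a. if j \<in> colors X e then 1 else 0)"
    proof (rule sum.cong[OF refl])
      fix e assume "e \<in> {..<p}"
      then have "colors X a \<inter> colors X e = colors X e" using True by auto
      then show "card (colors X e) = (\<Sum>j\<in>colors X a. if j \<in> colors X e then 1 else 0)"
        by (simp add: sum.If_cases finite_colors)
    qed
    also have "\<dots> = (\<Sum>j\<in>colors X a. \<Sum>e<p. if j \<in> colors X e then 1 else 0)"
      by (rule sum.swap)
    also have "\<dots> \<le> (\<Sum>j\<in>colors X a. p - 1)"
    proof (rule sum_mono)
      fix j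
      obtain e where "e < p" "j \<notin> colors X e" using color_missing[OF X(1)] by blast
      then have "{e. e < p \<and> j \<in> colors X e} \<subset> {..<p}" by auto
      then have "card {e. e < p \<and> j \<in> colors X e} < p"
        using psubset_card_mono[OF finite_lessThan, of "{e. e < p \<and> j \<in> colors X e}" p] by simp
      then show "(\<Sum>e<p. if j \<in> colors X e then 1 else 0) \<le> p - 1"
        by (simp add: sum.If_cases Int_def)
    qed
    finally have "?d \<le> (p - 1) * ?k" using d_le by (simp add: mult.commute)
    with \<open>?k \<le> ?M\<close> show ?thesis by blast
  qed
qed

end

section \<open>The lower bound for the local chromatic number\<close>

lemma kneser_edge_card:
  assumes "e \<in> edges (kneser p H)" "{} \<notin> edges H" "1 < p"
  shows "2 \<le> card e"
proof -
  obtain f where f: "e = f ` {1..p}" "f \<in> {1..p} \<rightarrow> edges H"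
    "\<forall>i\<in>{1..p}. \<forall>j\<in>{1..p}. i \<noteq> j \<longrightarrow> f i \<inter> f j = {}"
    using assms(1) unfolding kneser_def by auto
  have 12: "1 \<in> {1..p}" "2 \<in> {1..p}" "(1::nat) \<noteq> 2" using assms(3) by auto
  then have "f 1 \<inter> f 2 = {}" "{f 1, f 2} \<subseteq> e" using f by blast+
  moreover have "f 1 \<noteq> {}" using Pi_mem[OF f(2) 12(1)] assms(2) by auto
  ultimately have "f 1 \<inter> f 2 = {}" "f 1 \<noteq> {}" "{f 1, f 2} \<subseteq> e" by blast+
  then have "f 1 \<noteq> f 2" by auto
  then have "card {f 1, f 2} = 2" by simp
  moreover have "finite e" using f(1) by simp
  ultimately show ?thesis
    using \<open>{f 1, f 2} \<subseteq> e\<close> by (metis card_mono)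
qed

text \<open>
  An injective coloring is proper. Existence matters because the local chromatic number is an
  infimum of natural numbers, which would be \<open>0\<close> over the empty set.
\<close>

lemma ex_proper_coloring_kneser:
  assumes "hypergraph H" "{} \<notin> edges H" "1 < p"
  shows "\<exists>t c. proper_coloring (kneser p H) t c"
proof -
  have fin: "finite (edges H)" using assms(1) finite_subset unfolding hypergraph_def by auto
  then obtain c where c: "bij_betw c (edges H) {0..<card (edges H)}"
    using ex_bij_betw_finite_nat by blast
  have "card (Suc ` c ` e) \<noteq> 1" if e: "e \<in> edges (kneser p H)" for e
  proof -
    have "e \<subseteq> edges H" using e unfolding kneser_def by auto
    then have "card (Suc ` c ` e) = card e"
      using inj_on_subset[OF bij_betw_imp_inj_on[OF c]] by (simp add: card_image)
    then show ?thesis using kneser_edge_card[OF e assms(2,3)] by simp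
  qed
  moreover have "c E < card (edges H)" if "E \<in> edges H" for E
    using c that unfolding bij_betw_def by auto
  ultimately have "proper_coloring (kneser p H) (Suc (card (edges H))) (\<lambda>E. Suc (c E))"
    unfolding proper_coloring_def coloring_def
    by (auto simp: image_image kneser_def less_imp_le)
  then show ?thesis by blast
qed

theorem theorem2:
  fixes H :: "'a hypergraph" and p :: nat
  assumes "hypergraph H"
    and "{} \<notin> edges H"
    and "prime p"
  shows "int (local_chromatic_number (kneser p H)) \<ge>
    min (\<lceil>real (colorability_defect p H) / real p\<rceil> + 1)
        \<lceil>real (colorability_defect p H) / (real p - 1)\<rceil>"
proof -
  let ?d = "colorability_defect p H" and ?G = "kneser p H"
  have p1: "1 < p" using assms(3) by (rule prime_gt_1_nat)
  let ?S = "{max_local_colors ?G c | c. \<exists>t. proper_coloring ?G t c}"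
  have "?S \<noteq> {}" using ex_proper_coloring_kneser[OF assms(1,2) p1] by blast
  then have "Inf ?S \<in> ?S" by (rule Inf_nat_def1)
  then obtain c t where c: "proper_coloring ?G t c" and eq: "local_chromatic_number ?G = max_local_colors ?G c"
    unfolding local_chromatic_number_def by auto
  have "finite (verts H)" using assms(1) unfolding hypergraph_def by blast
  then obtain v where v: "bij_betw v {..<card (verts H)} (verts H)"
    using ex_bij_betw_nat_finite[of "verts H"] by (auto simp: atLeast0LessThan)
  interpret kneser_coloring H p t c v
    using assms c v by unfold_locales
  let ?M = "max_local_colors ?G c"
  have ceil: "\<lceil>real ?d / real q\<rceil> \<le> int k" if "?d \<le> q * k" "0 < q" for q k
  proof -
    have "real ?d \<le> real q * real k" using that(1) by (metis of_nat_le_iff of_nat_mult)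
    then have "real ?d / real q \<le> real k" using that(2) by (simp add: divide_le_eq mult.commute)
    then show ?thesis by (simp add: ceiling_le_iff)
  qed
  have rp: "real p - 1 = real (p - 1)" using p1 by simp
  \<comment> \<open>For \<open>d < p\<close> the second term of the minimum is at most 1.\<close>
  have "min (\<lceil>real ?d / real p\<rceil> + 1) \<lceil>real ?d / (real p - 1)\<rceil> \<le> int ?M"
  proof (cases "p \<le> ?d")
    case True
    then obtain k where "?d \<le> p * k \<and> k + 1 \<le> ?M \<or> ?d \<le> (p - 1) * k \<and> k \<le> ?M"
      using max_local_colors_lower_bound by blast
    then show ?thesis
      using ceil[of p k] ceil[of "p - 1" k] p1 unfolding rp by fastforce
  next
    case False
    then have "\<lceil>real ?d / real (p - 1)\<rceil> \<le> int 1" using p1 by (intro ceil) auto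
    moreover have "1 \<le> ?M"
    proof (cases "edges ?G = {}")
      case True
      then show ?thesis unfolding max_local_colors_def by simp
    next
      case False
      then obtain e where e: "e \<in> edges ?G" by blast
      have ce: "2 \<le> card e" by (rule kneser_edge_card[OF e assms(2) p1])
      then obtain E where E: "E \<in> e" by fastforce
      have "card (e - {E}) \<noteq> 0" using ce E by (simp add: card_Diff_singleton)
      then have "e - {E} \<noteq> {}" by (metis card.empty)
      then have "c ` closed_nbhd ?G (e - {E}) \<noteq> {}" unfolding closed_nbhd_def by blast
      then have "0 < card (c ` closed_nbhd ?G (e - {E}))"
        using finite_closed_nbhd[OF e] by (simp add: card_gt_0_iff)
      then show ?thesis using max_local_colors_ge[OF e E] by linarith
    qed
    ultimately show ?thesis unfolding rp by linarith
  qed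
  then show ?thesis unfolding eq .
qed

end
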